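(* Let $q$ be an odd prime power, let $\zeta$ be a symplectic polarity of $\mathrm{PG}(3,q)$ with associated symplectic graph $Sp(4,q)$, and let $S$ be a special spread of $\mathrm{PG}(3,q)$ with respect to $\zeta$. Let $\Gamma_{q,S}$ be the complement of the graph obtained from $Sp(4,q)$ by removing all the edges of each complete bipartite graph $K_{q+1,q+1}$ in the partition of the vertex set of $Sp(4,q)$ into $K_{q+1,q+1}$'s associated with $S$. Then $\Gamma_{q,S}$ is a divisible design graph with parameters $$(v,k,\lambda_1,\lambda_2,m,n)=\big((q^2+1)(q+1),\ q^3+q+1,\ q^3-q^2+q+1,\ q^3-q^2+2q,\ q^2+1,\ q+1\big).$$
   Context: A $k$-regular graph on $v$ vertices is a divisible design graph with parameters $(v,k,\lambda_1,\lambda_2,m,n)$ if its vertex set can be partitioned into $m$ classes of size $n$ such that any two distinct vertices from the same class have exactly $\lambda_1$ common neighbours and any two vertices from different classes have exactly $\lambda_2$ common neighbours. A symplectic polarity $\zeta$ of $\mathrm{PG}(3,q)$ is a polarity with $x\in x^\zeta$ for every point $x$. The graph $Sp(4,q)$ has the points of $\mathrm{PG}(3,q)$ as vertices, two distinct points $x,y$ being adjacent iff $y\in x^\zeta$ (i.e. $x$ and $y$ are orthogonal). A line $L$ is totally isotropic if $L^\zeta=L$. A spread is a set of lines of $\mathrm{PG}(3,q)$ partitioning its point set. For $q$ odd, a special spread is a spread $S$ consisting of lines that are not totally isotropic such that for every $\ell\in S$ there is a uniquely determined line $\ell'\in S$ such that any point of $\ell$ is orthogonal to any point of $\ell'$ (that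 is, $\ell'=\ell^\zeta$). For paired lines $\ell,\ell'\in S$, the set $\ell\cup\ell'$ induces in $Sp(4,q)$ a complete bipartite graph $K_{q+1,q+1}$ with parts $\ell$ and $\ell'$; these sets $\ell\cup\ell'$ form the partition of the vertex set into $K_{q+1,q+1}$'s associated with $S$. *)

theory Defs
  imports
    "HOL-Analysis.Cartesian_Space"
    "HOL-Library.Disjoint_Sets"
    "HOL-Number_Theory.Prime_Powers"
    "Graph_Theory.Pair_Digraph"
begin

text \<open>
  Graphs are the finite, loopless, symmetric digraphs of \<^locale>\<open>pair_graph\<close>: every edge is
  represented by its two arcs. In such a graph the degree of a vertex is its out-degree.
\<close>

definition regular_graph :: "'v pair_pre_digraph \<Rightarrow> nat \<Rightarrow> bool" where
  "regular_graph G k \<longleftrightarrow> pair_graph G \<and> (\<forall>x \<in> pverts G. out_degree (with_proj G) x = k)"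

definition common_neighbours :: "'v pair_pre_digraph \<Rightarrow> 'v \<Rightarrow> 'v \<Rightarrow> 'v set" where
  "common_neighbours G x y = {z \<in> pverts G. (x, z) \<in> parcs G \<and> (y, z) \<in> parcs G}"

definition divisible_design_graph ::
  "'v pair_pre_digraph \<Rightarrow> nat \<Rightarrow> nat \<Rightarrow> nat \<Rightarrow> nat \<Rightarrow> nat \<Rightarrow> nat \<Rightarrow> bool" where
  "divisible_design_graph G v k l1 l2 m n \<longleftrightarrow>
     regular_graph G k \<and> card (pverts G) = v \<and>
     (\<exists>\<P>. partition_on (pverts G) \<P> \<and> card \<P> = m \<and> (\<forall>C \<in> \<P>. card C = n) \<and>
        (\<forall>C \<in> \<P>. \<forall>x \<in> C. \<forall>y \<in> C. x \<noteq> y \<longrightarrow> card (common_neighbours G x y) = l1) \<and>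
        (\<forall>C \<in> \<P>. \<forall>D \<in> \<P>. C \<noteq> D \<longrightarrow>
           (\<forall>x \<in> C. \<forall>y \<in> D. card (common_neighbours G x y) = l2)))"

definition complement_graph :: "'v pair_pre_digraph \<Rightarrow> 'v pair_pre_digraph" where
  "complement_graph G =
     \<lparr> pverts = pverts G,
       parcs = {(x, y). x \<in> pverts G \<and> y \<in> pverts G \<and> x \<noteq> y \<and> (x, y) \<notin> parcs G} \<rparr>"

text \<open>Remove, for every vertex set in \<open>\<B>\<close>, all edges of the subgraph it induces.\<close>

definition remove_induced_edges :: "'v pair_pre_digraph \<Rightarrow> 'v set set \<Rightarrow> 'v pair_pre_digraph" where
  "remove_induced_edges G \<B> =
     \<lparr> pverts = pverts G, parcs = parcs G - (\<Union>B \<in> \<B>. parcs G \<inter> B \<times> B) \<rparr>"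

text \<open>
  The projective space of dimension 3 over the field \<open>'a\<close>: its subspaces are the linear subspaces
  of \<^typ>\<open>'a ^ 4\<close>, incidence is inclusion, and points and lines have linear dimension 1 and 2.
\<close>

type_synonym 'a pg_subspace = "('a ^ 4) set"

definition pg_points :: "'a::field pg_subspace set" where
  "pg_points = {p. vec.subspace p \<and> vec.dim p = 1}"

definition pg_lines :: "'a::field pg_subspace set" where
  "pg_lines = {l. vec.subspace l \<and> vec.dim l = 2}"

definition points_on :: "'a::field pg_subspace \<Rightarrow> 'a pg_subspace set" where
  "points_on U = {p \<in> pg_points. p \<subseteq> U}"

text \<open>A polarity is an inclusion-reversing involution on subspaces (only its values there matter).\<close>

definition polarity :: "('a::field pg_subspace \<Rightarrow> 'a pg_subspace) \<Rightarrow> bool" where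
  "polarity \<zeta> \<longleftrightarrow>
     (\<forall>U. vec.subspace U \<longrightarrow> vec.subspace (\<zeta> U) \<and> \<zeta> (\<zeta> U) = U) \<and>
     (\<forall>U W. vec.subspace U \<and> vec.subspace W \<and> U \<subseteq> W \<longrightarrow> \<zeta> W \<subseteq> \<zeta> U)"

definition symplectic_polarity :: "('a::field pg_subspace \<Rightarrow> 'a pg_subspace) \<Rightarrow> bool" where
  "symplectic_polarity \<zeta> \<longleftrightarrow> polarity \<zeta> \<and> (\<forall>x \<in> pg_points. x \<subseteq> \<zeta> x)"

definition orthogonal_points ::
  "('a::field pg_subspace \<Rightarrow> 'a pg_subspace) \<Rightarrow> 'a pg_subspace \<Rightarrow> 'a pg_subspace \<Rightarrow> bool" where
  "orthogonal_points \<zeta> x y \<longleftrightarrow> y \<subseteq> \<zeta> x"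

definition symplectic_graph ::
  "('a::field pg_subspace \<Rightarrow> 'a pg_subspace) \<Rightarrow> 'a pg_subspace pair_pre_digraph" where
  "symplectic_graph \<zeta> =
     \<lparr> pverts = pg_points,
       parcs = {(x, y). x \<in> pg_points \<and> y \<in> pg_points \<and> x \<noteq> y \<and> orthogonal_points \<zeta> x y} \<rparr>"

definition totally_isotropic ::
  "('a::field pg_subspace \<Rightarrow> 'a pg_subspace) \<Rightarrow> 'a pg_subspace \<Rightarrow> bool" where
  "totally_isotropic \<zeta> L \<longleftrightarrow> \<zeta> L = L"

text \<open>On lines \<^const>\<open>points_on\<close> is injective, so its image loses no line of \<open>S\<close>.\<close>

definition spread :: "'a::field pg_subspace set \<Rightarrow> bool" where
  "spread S \<longleftrightarrow> S \<subseteq> pg_lines \<and> partition_on pg_points (points_on ` S)"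

definition orthogonal_lines ::
  "('a::field pg_subspace \<Rightarrow> 'a pg_subspace) \<Rightarrow> 'a pg_subspace \<Rightarrow> 'a pg_subspace \<Rightarrow> bool" where
  "orthogonal_lines \<zeta> l l' \<longleftrightarrow>
     (\<forall>x \<in> points_on l. \<forall>y \<in> points_on l'. orthogonal_points \<zeta> x y)"

definition special_spread ::
  "('a::field pg_subspace \<Rightarrow> 'a pg_subspace) \<Rightarrow> 'a pg_subspace set \<Rightarrow> bool" where
  "special_spread \<zeta> S \<longleftrightarrow>
     spread S \<and> (\<forall>l \<in> S. \<not> totally_isotropic \<zeta> l) \<and>
     (\<forall>l \<in> S. \<exists>!l'. l' \<in> S \<and> orthogonal_lines \<zeta> l l')"

text \<open>
  The vertex sets of the complete bipartite graphs associated with a special spread; the subgraph of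
  the symplectic graph induced on such a set is complete bipartite with parts the points of \<open>l\<close>
  and of \<open>l'\<close>.
\<close>

definition bipartite_blocks ::
  "('a::field pg_subspace \<Rightarrow> 'a pg_subspace) \<Rightarrow> 'a pg_subspace set \<Rightarrow> 'a pg_subspace set set" where
  "bipartite_blocks \<zeta> S =
     {points_on l \<union> points_on l' | l l'. l \<in> S \<and> l' \<in> S \<and> orthogonal_lines \<zeta> l l'}"

definition \<Gamma>_graph ::
  "('a::field pg_subspace \<Rightarrow> 'a pg_subspace) \<Rightarrow> 'a pg_subspace set \<Rightarrow>
   'a pg_subspace pair_pre_digraph" where
  "\<Gamma>_graph \<zeta> S =
     complement_graph (remove_induced_edges (symplectic_graph \<zeta>) (bipartite_blocks \<zeta> S))"

end

theory Submission
  imports Defs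
begin

text \<open>
  Only the lattice duality given by \<open>\<zeta>\<close> is needed, not an alternating form: reversing strict
  inclusions forces \<open>dim (\<zeta> U) = 4 - dim U\<close>, and the line paired with \<open>l \<in> S\<close> is \<open>\<zeta> l\<close>. Two
  distinct points of the non-isotropic line \<open>l\<close> are never orthogonal, so the neighbourhood of a
  point \<open>x\<close> on \<open>l\<close> consists of the \<open>q^3\<close> points off the plane \<open>\<zeta> x\<close> together with the \<open>q + 1\<close>
  points of \<open>\<zeta> l\<close>. Any two planes \<open>\<zeta> x\<close>, \<open>\<zeta> y\<close> leave \<open>q^3 - q^2\<close> points uncovered. If \<open>x\<close> and
  \<open>y\<close> lie on the same \<open>l\<close>, the line \<open>\<zeta> l\<close> adds \<open>q + 1\<close> common neighbours; if they lie on different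
  \<open>l\<close> and \<open>m\<close>, then \<open>\<zeta> l\<close> and \<open>\<zeta> m\<close> are disjoint, each meets the other point's plane in one
  point, and together they add \<open>2 q\<close>.
\<close>

section \<open>Counting points of subspaces\<close>

text \<open>Each vector of \<open>span (insert b B)\<close> is \<open>k *s b + s\<close> for exactly
  one scalar \<open>k\<close> and one \<open>s\<close> in \<open>span B\<close>, so every new basis
  vector multiplies the size by the order of the field.\<close>

lemma card_vec_span_independent:
  fixes B :: "('a::{field,finite} ^ 'n) set"
  assumes "vec.independent B"
  shows "card (vec.span B) = CARD('a) ^ card B"
proof -
  have "finite B" by simp
  then show ?thesis using assms
  proof (induction B rule: finite_induct)
    case empty
    then show ?case by simp
  next
    case (insert b B)
    have ind: "vec.independent B" and b: "b \<notin> vec.span B"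
      using insert.prems insert.hyps by (auto simp: vec.independent_insert)
    let ?f = "\<lambda>(k, s). k *s b + s"
    have "inj_on ?f (UNIV \<times> vec.span B)"
    proof (rule inj_onI, clarify)
      fix k s k' s'
      assume s: "s \<in> vec.span B" "s' \<in> vec.span B" and eq: "k *s b + s = k' *s b + s'"
      have "k = k'"
      proof (rule ccontr)
        assume "k \<noteq> k'"
        from eq have "(k - k') *s b = s' - s"
          by (simp add: vec.scale_left_diff_distrib algebra_simps)
        then have "(k - k') *s b \<in> vec.span B" using s by (simp add: vec.span_diff)
        then have "inverse (k - k') *s ((k - k') *s b) \<in> vec.span B" by (rule vec.span_scale)
        then have "b \<in> vec.span B" using \<open>k \<noteq> k'\<close> by simp
        with b show False by simp
      qed
      with eq show "k = k' \<and> s = s'" by simp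
    qed
    moreover have "vec.span (insert b B) = ?f ` (UNIV \<times> vec.span B)"
    proof
      show "vec.span (insert b B) \<subseteq> ?f ` (UNIV \<times> vec.span B)"
      proof
        fix x assume "x \<in> vec.span (insert b B)"
        then obtain k where "x - k *s b \<in> vec.span B" by (auto simp: vec.span_insert)
        then show "x \<in> ?f ` (UNIV \<times> vec.span B)"
          by (intro image_eqI[of _ _ "(k, x - k *s b)"]) auto
      qed
      show "?f ` (UNIV \<times> vec.span B) \<subseteq> vec.span (insert b B)"
        using vec.span_mono[OF subset_insertI[of B b]]
        by (auto simp: vec.span_add vec.span_scale vec.span_base)
    qed
    ultimately show ?case
      using insert.IH[OF ind] insert.hyps
      by (simp add: card_image card_cartesian_product)
  qed
qed

lemma card_vec_subspace:
  fixes U :: "('a::{field,finite} ^ 'n) set"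
  assumes "vec.subspace U"
  shows "card U = CARD('a) ^ vec.dim U"
proof -
  obtain B where B: "B \<subseteq> U" "vec.independent B" "U \<subseteq> vec.span B" "card B = vec.dim U"
    using vec.basis_exists by blast
  then have "vec.span B = U" using assms by (simp add: vec.span_subspace)
  with card_vec_span_independent[OF B(2)] B(4) show ?thesis by simp
qed

lemma pg_point_span: "v \<noteq> 0 \<Longrightarrow> vec.span {v} \<in> pg_points"
  by (simp add: pg_points_def)

text \<open>A nonzero vector spans every point that contains it, so distinct points share only the
  zero vector.\<close>

lemma pg_point_eq:
  assumes "p \<in> pg_points" "r \<in> pg_points" "v \<in> p" "v \<in> r" "v \<noteq> 0"
  shows "p = r"
proof -
  have "vec.span {v} = s" if "s \<in> pg_points" "v \<in> s" for s
    using that assms(5)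
    by (intro vec.subspace_dim_equal) (simp_all add: pg_points_def vec.span_minimal)
  then show ?thesis using assms by metis
qed

text \<open>Every nonzero vector of \<open>U\<close> spans a point of \<open>U\<close>, so a
  subspace is determined by its points. In particular \<open>points_on\<close> is injective on
  subspaces.\<close>

lemma points_on_subset_iff:
  assumes "vec.subspace U" "vec.subspace W"
  shows "points_on U \<subseteq> points_on W \<longleftrightarrow> U \<subseteq> W"
proof
  assume sub: "points_on U \<subseteq> points_on W"
  show "U \<subseteq> W"
  proof
    fix v assume v: "v \<in> U"
    show "v \<in> W"
    proof (cases "v = 0")
      case True
      then show ?thesis using assms vec.subspace_0 by auto
    next
      case False
      then have "vec.span {v} \<in> points_on U"
        using v assms by (simp add: points_on_def pg_point_span vec.span_minimal)
      then have "vec.span {v} \<subseteq> W" using sub by (auto simp: points_on_def)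
      then show ?thesis by (meson insertI1 subsetD vec.span_base)
    qed
  qed
qed (auto simp: points_on_def)

lemma points_on_Int: "points_on (U \<inter> W) = points_on U \<inter> points_on W"
  by (auto simp: points_on_def)

lemma points_on_UNIV: "points_on UNIV = pg_points"
  by (simp add: points_on_def)

text \<open>Deleting 0 from the points on \<open>U\<close> partitions the nonzero vectors of
  \<open>U\<close> into sets of size \<open>CARD('a) - 1\<close>. The product form avoids
  division.\<close>

lemma card_points_on:
  fixes U :: "('a::{field,finite} ^ 4) set"
  assumes "vec.subspace U"
  shows "(CARD('a) - 1) * card (points_on U) = CARD('a) ^ vec.dim U - 1"
proof -
  let ?C = "(\<lambda>p. p - {0}) ` points_on U"
  have z: "0 \<in> p" if "p \<in> points_on U" for p
    using that by (simp add: points_on_def pg_points_def vec.subspace_0)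
  have inj: "inj_on (\<lambda>p. p - {0}) (points_on U)"
    by (rule inj_onI) (metis z insert_Diff)
  have "(CARD('a) - 1) * card ?C = card (\<Union>?C)"
  proof (rule card_partition)
    show "card c = CARD('a) - 1" if c: "c \<in> ?C" for c
    proof -
      obtain p where p: "p \<in> points_on U" "c = p - {0}" using c by blast
      have "card p = CARD('a)" using card_vec_subspace[of p] p by (simp add: points_on_def pg_points_def)
      then show ?thesis using z p by simp
    qed
    show "c1 \<inter> c2 = {}" if c: "c1 \<in> ?C" "c2 \<in> ?C" "c1 \<noteq> c2" for c1 c2
    proof -
      obtain p r where pr: "p \<in> points_on U" "r \<in> points_on U" "c1 = p - {0}" "c2 = r - {0}"
        using c by blast
      then have "p \<noteq> r" using c(3) by blast
      then have "v = 0" if "v \<in> p" "v \<in> r" for v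
        using pg_point_eq[OF _ _ that] pr(1,2) by (auto simp: points_on_def)
      then show ?thesis using pr(3,4) by blast
    qed
  qed auto
  also have "\<Union>?C = U - {0}"
  proof
    show "U - {0} \<subseteq> \<Union>?C"
    proof
      fix v assume v: "v \<in> U - {0}"
      then have "vec.span {v} \<in> points_on U"
        using assms by (simp add: points_on_def pg_point_span vec.span_minimal)
      moreover have "v \<in> vec.span {v} - {0}" using v by (simp add: vec.span_base)
      ultimately show "v \<in> \<Union>?C" by blast
    qed
  qed (auto simp: points_on_def)
  also have "card (U - {0}) = CARD('a) ^ vec.dim U - 1"
    using assms by (simp add: vec.subspace_0 card_vec_subspace)
  finally show ?thesis using inj by (simp add: card_image)
qed

lemma card_points_on_geometric:
  fixes U :: "('a::{field,finite} ^ 4) set"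
  assumes "vec.subspace U"
  shows "card (points_on U) = (\<Sum>i<vec.dim U. CARD('a) ^ i)"
proof -
  have "card {0, 1::'a} \<le> CARD('a)" by (intro card_mono) auto
  then have q: "CARD('a) \<ge> 2" by simp
  have "(CARD('a) - 1) * (\<Sum>i<d. CARD('a) ^ i) = CARD('a) ^ d - 1" for d
  proof -
    \<comment> \<open>Over the integers subtraction is not truncated, so the geometric sum identity
      applies.\<close>
    have "int ((CARD('a) - 1) * (\<Sum>i<d. CARD('a) ^ i)) = int (CARD('a) ^ d - 1)"
      using q power_diff_1_eq[of "int CARD('a)" d] by (simp add: of_nat_diff)
    then show ?thesis by linarith
  qed
  with card_points_on[OF assms]
  have "(CARD('a) - 1) * card (points_on U) = (CARD('a) - 1) * (\<Sum>i<vec.dim U. CARD('a) ^ i)"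
    by simp
  with q show ?thesis by simp
qed

text \<open>The sum of \<open>U\<close> and \<open>W\<close> strictly contains the three-dimensional
  \<open>U\<close>, hence has dimension 4; the dimension formula for sums then gives the
  intersection.\<close>

lemma dim_Int_hyperplane:
  fixes U W :: "('a::field ^ 4) set"
  assumes "vec.subspace U" "vec.subspace W" "vec.dim U = 3" "\<not> W \<subseteq> U"
  shows "vec.dim (U \<inter> W) + 1 = vec.dim W"
proof -
  let ?T = "{x + y |x y. x \<in> U \<and> y \<in> W}"
  have T: "vec.subspace ?T" using assms vec.subspace_sums by blast
  have "U \<subseteq> ?T" "W \<subseteq> ?T"
    using assms(1,2) vec.subspace_0 by (force intro: exI[of _ "0::'a^4"])+
  then have "U \<noteq> ?T" using assms(4) by blast
  then have "vec.dim U < vec.dim ?T"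
    using vec.subspace_dim_equal[OF assms(1) T \<open>U \<subseteq> ?T\<close>] by linarith
  moreover have "vec.dim ?T \<le> 4"
    using vec.dim_subset_UNIV[of ?T] by (simp add: vec.dimension_def card_cart_basis)
  ultimately show ?thesis using vec.dim_sums_Int[OF assms(1,2)] assms(3) by linarith
qed

section \<open>Polarities\<close>

lemma polarity_subset_iff:
  assumes "polarity \<zeta>" "vec.subspace U" "vec.subspace W"
  shows "\<zeta> U \<subseteq> \<zeta> W \<longleftrightarrow> W \<subseteq> U"
  using assms unfolding polarity_def by metis

lemma dim_polarity:
  fixes \<zeta> :: "('a::field ^ 4) set \<Rightarrow> ('a ^ 4) set"
  assumes pol: "polarity \<zeta>" and U: "vec.subspace U"
  shows "vec.dim (\<zeta> U) + vec.dim U = 4"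
proof -
  have sub: "vec.subspace (\<zeta> W)" if "vec.subspace W" for W
    using pol that by (simp add: polarity_def)
  \<comment> \<open>Strict inclusions stay strict under \<open>\<zeta>\<close>, and between
    subspaces a strict inclusion changes the dimension by at least one.\<close>
  have less: "vec.dim (\<zeta> W) < vec.dim (\<zeta> V)" if "vec.subspace V" "vec.subspace W" "V \<subset> W" for V W
  proof -
    have "\<zeta> W \<subseteq> \<zeta> V" "\<not> \<zeta> V \<subseteq> \<zeta> W"
      using that polarity_subset_iff[OF pol] by auto
    then have "\<not> vec.dim (\<zeta> V) \<le> vec.dim (\<zeta> W)"
      using vec.subspace_dim_equal[OF sub[OF that(2)] sub[OF that(1)]] by blast
    then show ?thesis by simp
  qed
  have le4: "vec.dim W \<le> 4" for W :: "('a ^ 4) set"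
    using vec.dim_subset_UNIV[of W] by (simp add: vec.dimension_def card_cart_basis)
  \<comment> \<open>The two bounds come from chains of subspaces descending to \<open>0\<close> and ascending to the whole space.\<close>
  have upper: "vec.dim (\<zeta> W) + vec.dim W \<le> 4" if "vec.subspace W" for W
    using that
  proof (induction "vec.dim W" arbitrary: W)
    case 0
    then show ?case using le4[of "\<zeta> W"] by linarith
  next
    case (Suc d)
    then have "d \<le> vec.dim W" by simp
    then obtain V where V: "vec.subspace V" "V \<subseteq> vec.span W" "vec.dim V = d"
      using vec.choose_subspace_of_subspace by blast
    have "vec.span W = W" using Suc.prems by (simp add: vec.span_eq_iff)
    with V Suc.hyps(2) have "V \<subset> W" by auto
    then have "vec.dim (\<zeta> W) < vec.dim (\<zeta> V)" using less V(1) Suc.prems by simp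
    moreover have "vec.dim (\<zeta> V) + vec.dim V \<le> 4" using Suc.hyps(1)[of V] V by simp
    ultimately show ?case using V(3) Suc.hyps(2) by linarith
  qed
  have lower: "4 \<le> vec.dim (\<zeta> W) + vec.dim W" if "vec.subspace W" for W
    using that
  proof (induction "4 - vec.dim W" arbitrary: W)
    case 0
    then show ?case by simp
  next
    case (Suc d)
    have "W \<noteq> UNIV" using Suc.hyps(2) by (auto simp: card_cart_basis)
    then obtain v where v: "v \<notin> W" by blast
    let ?V = "vec.span (insert v W)"
    have d: "vec.dim ?V = vec.dim W + 1"
      using v Suc.prems by (simp add: vec.dim_insert vec.span_eq_iff[THEN iffD2])
    have "W \<subset> ?V" using v by (auto intro: vec.span_base)
    then have "vec.dim (\<zeta> ?V) < vec.dim (\<zeta> W)" using less Suc.prems by simp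
    moreover have "4 \<le> vec.dim (\<zeta> ?V) + vec.dim ?V" using Suc.hyps(1)[of ?V] Suc.hyps(2) d by simp
    ultimately show ?case using d by linarith
  qed
  from upper[OF U] lower[OF U] show ?thesis by linarith
qed

text \<open>Applying \<open>\<zeta>\<close> to \<open>U \<subseteq> \<zeta> W\<close> reverses it to
  \<open>W \<subseteq> \<zeta> U\<close>, since \<open>\<zeta>\<close> is an involution. This makes
  adjacency symmetric.\<close>

lemma orthogonal_subspace_sym:
  assumes "polarity \<zeta>" "vec.subspace U" "vec.subspace W"
  shows "U \<subseteq> \<zeta> W \<longleftrightarrow> W \<subseteq> \<zeta> U"
  using assms unfolding polarity_def by metis

text \<open>If all points are pairwise orthogonal, then \<open>l'\<close> lies in
  \<open>\<zeta> x\<close> for each point \<open>x\<close> of \<open>l\<close>; so \<open>x\<close>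
  lies in \<open>\<zeta> l'\<close>, hence \<open>l\<close> does, and by symmetry
  \<open>l' \<subseteq> \<zeta> l\<close> with both of dimension 2. Conversely,
  \<open>x \<subseteq> l\<close> gives \<open>\<zeta> l \<subseteq> \<zeta> x\<close>.\<close>

lemma orthogonal_lines_iff:
  fixes \<zeta> :: "('a::field ^ 4) set \<Rightarrow> ('a ^ 4) set"
  assumes pol: "polarity \<zeta>" and l: "l \<in> pg_lines" and l': "l' \<in> pg_lines"
  shows "orthogonal_lines \<zeta> l l' \<longleftrightarrow> l' = \<zeta> l"
proof
  have ls: "vec.subspace l" "vec.subspace l'" "vec.dim l = 2" "vec.dim l' = 2"
    using l l' by (auto simp: pg_lines_def)
  have sub: "vec.subspace (\<zeta> U)" if "vec.subspace U" for U
    using pol that by (simp add: polarity_def)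
  have pt: "vec.subspace x" if "x \<in> points_on U" for x U
    using that by (simp add: points_on_def pg_points_def)
  {
    assume orth: "orthogonal_lines \<zeta> l l'"
    have "points_on l \<subseteq> points_on (\<zeta> l')"
    proof
      fix x assume x: "x \<in> points_on l"
      then have "points_on l' \<subseteq> points_on (\<zeta> x)"
        using orth unfolding orthogonal_lines_def orthogonal_points_def points_on_def by blast
      then have "l' \<subseteq> \<zeta> x" using points_on_subset_iff ls sub pt x by blast
      then have "x \<subseteq> \<zeta> l'" using orthogonal_subspace_sym[OF pol ls(2) pt[OF x]] by simp
      then show "x \<in> points_on (\<zeta> l')" using x by (simp add: points_on_def)
    qed
    then have "l \<subseteq> \<zeta> l'" using points_on_subset_iff ls sub by blast
    then have "l' \<subseteq> \<zeta> l" using orthogonal_subspace_sym[OF pol ls(1,2)] by simp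
    then show "l' = \<zeta> l"
      using vec.subspace_dim_equal[OF ls(2) sub[OF ls(1)]] dim_polarity[OF pol ls(1)] ls by simp
  }
  assume eq: "l' = \<zeta> l"
  have "y \<subseteq> \<zeta> x" if "x \<in> points_on l" "y \<in> points_on l'" for x y
  proof -
    have "\<zeta> l \<subseteq> \<zeta> x"
      using polarity_subset_iff[OF pol ls(1) pt[OF that(1)]] that(1) by (simp add: points_on_def)
    then show ?thesis using that(2) eq by (auto simp: points_on_def)
  qed
  then show "orthogonal_lines \<zeta> l l'" by (simp add: orthogonal_lines_def orthogonal_points_def)
qed

text \<open>If \<open>l \<inter> U\<close> had dimension at most 1, every point of \<open>l\<close>
  inside \<open>U\<close> would equal it, so there could not be two.\<close>

lemma line_subset_if_two_points:
  assumes "l \<in> pg_lines" "vec.subspace U"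
    and x: "x \<in> points_on l" "x \<subseteq> U" and y: "y \<in> points_on l" "y \<subseteq> U" and "x \<noteq> y"
  shows "l \<subseteq> U"
proof -
  have l: "vec.subspace l" "vec.dim l = 2" using assms by (auto simp: pg_lines_def)
  have I: "vec.subspace (l \<inter> U)" using l assms by (simp add: vec.subspace_inter)
  have eq: "p = l \<inter> U" if "vec.dim (l \<inter> U) \<le> 1" "p \<in> points_on l" "p \<subseteq> U" for p
    using that I by (intro vec.subspace_dim_equal) (simp_all add: points_on_def pg_points_def)
  have "\<not> vec.dim (l \<inter> U) \<le> 1" using eq x y \<open>x \<noteq> y\<close> by blast
  then have "l \<inter> U = l" using I l by (intro vec.subspace_dim_equal) simp_all
  then show ?thesis by blast
qed

text \<open>Were \<open>x\<close> and \<open>y\<close> orthogonal, both \<open>\<zeta> x\<close> and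
  \<open>\<zeta> y\<close> would contain two points of \<open>l\<close>, hence \<open>l\<close>.
  Then \<open>\<zeta> l\<close> contains \<open>x\<close> and \<open>y\<close>, hence
  \<open>l\<close>, and equality of dimensions makes \<open>l\<close> totally isotropic.\<close>

lemma not_orthogonal_on_nonisotropic_line:
  assumes symp: "symplectic_polarity \<zeta>" and l: "l \<in> pg_lines" "\<not> totally_isotropic \<zeta> l"
    and x: "x \<in> points_on l" and y: "y \<in> points_on l" and "x \<noteq> y"
  shows "\<not> y \<subseteq> \<zeta> x"
proof
  assume yx: "y \<subseteq> \<zeta> x"
  have pol: "polarity \<zeta>" using symp by (simp add: symplectic_polarity_def)
  have ls: "vec.subspace l" "vec.dim l = 2" using l by (auto simp: pg_lines_def)
  have xs: "vec.subspace x" "x \<subseteq> \<zeta> x" and ys: "vec.subspace y" "y \<subseteq> \<zeta> y"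
    using x y symp by (simp_all add: symplectic_polarity_def points_on_def pg_points_def)
  have sub: "vec.subspace (\<zeta> U)" if "vec.subspace U" for U
    using pol that by (simp add: polarity_def)
  have xy: "x \<subseteq> \<zeta> y" using yx orthogonal_subspace_sym[OF pol xs(1) ys(1)] by simp
  have "l \<subseteq> \<zeta> x" "l \<subseteq> \<zeta> y"
    using line_subset_if_two_points[OF l(1) sub x _ y _ \<open>x \<noteq> y\<close>] xs ys yx xy by simp_all
  then have "x \<subseteq> \<zeta> l" "y \<subseteq> \<zeta> l"
    using orthogonal_subspace_sym[OF pol ls(1)] xs ys by simp_all
  then have "l \<subseteq> \<zeta> l" by (rule line_subset_if_two_points[OF l(1) sub[OF ls(1)] x _ y _ \<open>x \<noteq> y\<close>])
  then have "l = \<zeta> l"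
    using vec.subspace_dim_equal[OF ls(1) sub[OF ls(1)]] dim_polarity[OF pol ls(1)] ls by simp
  with l(2) show False by (simp add: totally_isotropic_def)
qed

section \<open>Neighbourhoods\<close>

locale special_spread_polarity =
  fixes \<zeta> :: "('a::{field,finite} ^ 4) set \<Rightarrow> ('a ^ 4) set" and S :: "('a ^ 4) set set"
  assumes symplectic: "symplectic_polarity \<zeta>" and special: "special_spread \<zeta> S"
begin

lemma pol: "polarity \<zeta>"
  using symplectic by (simp add: symplectic_polarity_def)

lemma subspace_polar: "vec.subspace U \<Longrightarrow> vec.subspace (\<zeta> U)"
  using pol by (simp add: polarity_def)

lemma polar_polar: "vec.subspace U \<Longrightarrow> \<zeta> (\<zeta> U) = U"
  using pol by (simp add: polarity_def)

lemma point_simps: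
  assumes "x \<in> pg_points"
  shows "vec.subspace x" "x \<subseteq> \<zeta> x" "vec.dim (\<zeta> x) = 3"
  using assms symplectic dim_polarity[OF pol, of x]
  by (simp_all add: symplectic_polarity_def pg_points_def)

lemma spread_line:
  assumes "l \<in> S"
  shows "l \<in> pg_lines" "vec.subspace l" "\<not> totally_isotropic \<zeta> l" "\<zeta> l \<noteq> l"
    "vec.dim (\<zeta> l) = 2"
  using assms special dim_polarity[OF pol, of l]
  by (auto simp: special_spread_def spread_def pg_lines_def totally_isotropic_def)

text \<open>The partner of \<open>l\<close> provided by the special spread can only be
  \<open>\<zeta> l\<close>, so \<open>\<zeta>\<close> acts on \<open>S\<close> as an
  involution.\<close>

lemma polar_in_spread:
  assumes "l \<in> S"
  shows "\<zeta> l \<in> S"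
proof -
  obtain l' where "l' \<in> S" "orthogonal_lines \<zeta> l l'"
    using special assms by (auto simp: special_spread_def)
  then show ?thesis using orthogonal_lines_iff[OF pol] spread_line(1) assms by metis
qed

lemma partition_points: "partition_on pg_points (points_on ` S)"
  using special by (simp add: special_spread_def spread_def)

lemma spread_line_unique:
  assumes "l \<in> S" "m \<in> S" "x \<in> points_on l" "x \<in> points_on m"
  shows "l = m"
proof -
  have "points_on l = points_on m"
    using partition_onD2[OF partition_points] assms by (auto dest: disjointD)
  then show ?thesis using points_on_subset_iff assms(1,2)[THEN spread_line(2)] by blast
qed

text \<open>Since partners are polar to each other, one line determines a block; each block arises
  twice, from \<open>l\<close> and from \<open>\<zeta> l\<close>.\<close>

lemma bipartite_blocks_eq: "bipartite_blocks \<zeta> S = (\<lambda>l. points_on l \<union> points_on (\<zeta> l)) ` S"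
proof -
  have "orthogonal_lines \<zeta> l l' \<longleftrightarrow> l' = \<zeta> l" if "l \<in> S" "l' \<in> S" for l l'
    using that orthogonal_lines_iff[OF pol] spread_line(1) by blast
  then show ?thesis using polar_in_spread unfolding bipartite_blocks_def by blast
qed

text \<open>Complementation turns the removed edges into the only adjacencies between orthogonal
  points, namely those inside a common block.\<close>

lemma arc_\<Gamma>_iff:
  "(x, z) \<in> parcs (\<Gamma>_graph \<zeta> S) \<longleftrightarrow>
     x \<in> pg_points \<and> z \<in> pg_points \<and> x \<noteq> z \<and>
     (z \<subseteq> \<zeta> x \<longrightarrow> (\<exists>B \<in> bipartite_blocks \<zeta> S. x \<in> B \<and> z \<in> B))"
  by (auto simp: \<Gamma>_graph_def complement_graph_def remove_induced_edges_def symplectic_graph_def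
      orthogonal_points_def)

text \<open>Meant for the spread line \<open>l\<close> through \<open>x\<close>, which is passed
  explicitly so that it need not be chosen.\<close>

definition neighbourhood :: "('a ^ 4) set \<Rightarrow> ('a ^ 4) set \<Rightarrow> ('a ^ 4) set set" where
  "neighbourhood l x = (pg_points - points_on (\<zeta> x)) \<union> points_on (\<zeta> l)"

text \<open>Points off the plane \<open>\<zeta> x\<close> are adjacent to \<open>x\<close> at once.
  A point of the plane must share a block with \<open>x\<close>; the only block through
  \<open>x\<close> consists of \<open>l\<close> and \<open>\<zeta> l\<close>, and no further point
  of \<open>l\<close> is orthogonal to \<open>x\<close>.\<close>

lemma arc_\<Gamma>_iff_neighbourhood:
  assumes l: "l \<in> S" and x: "x \<in> points_on l"
  shows "(x, z) \<in> parcs (\<Gamma>_graph \<zeta> S) \<longleftrightarrow> z \<in> neighbourhood l x"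
proof
  have xp: "x \<in> pg_points" using x by (simp add: points_on_def)
  {
    assume arc: "(x, z) \<in> parcs (\<Gamma>_graph \<zeta> S)"
    then have z: "z \<in> pg_points" "x \<noteq> z" by (simp_all add: arc_\<Gamma>_iff)
    show "z \<in> neighbourhood l x"
    proof (cases "z \<subseteq> \<zeta> x")
      case True
      then obtain m where m: "m \<in> S" "x \<in> points_on m \<union> points_on (\<zeta> m)"
        "z \<in> points_on m \<union> points_on (\<zeta> m)"
        using arc unfolding arc_\<Gamma>_iff bipartite_blocks_eq by blast
      have "z \<notin> points_on l"
        using not_orthogonal_on_nonisotropic_line[OF symplectic spread_line(1,3)[OF l] x _ z(2)] True
        by blast
      \<comment> \<open>The point \<open>x\<close> lies on exactly one spread line, so that line is
        \<open>m\<close> or its partner.\<close>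
      moreover have "m = l \<or> m = \<zeta> l"
      proof (cases "x \<in> points_on m")
        case True
        then show ?thesis using spread_line_unique[OF m(1) l] x by blast
      next
        case False
        then have "\<zeta> m = l" using spread_line_unique[OF polar_in_spread[OF m(1)] l] x m(2) by blast
        then show ?thesis using polar_polar[OF spread_line(2)[OF m(1)]] by blast
      qed
      ultimately have "z \<in> points_on (\<zeta> l)" using m(3) polar_polar[OF spread_line(2)[OF l]] by auto
      then show ?thesis by (simp add: neighbourhood_def)
    qed (simp add: neighbourhood_def z points_on_def)
  }
  assume z: "z \<in> neighbourhood l x"
  then have zp: "z \<in> pg_points" by (auto simp: neighbourhood_def points_on_def)
  show "(x, z) \<in> parcs (\<Gamma>_graph \<zeta> S)"
  proof (cases "z \<in> points_on (\<zeta> l)")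
    case True
    \<comment> \<open>The lines \<open>l\<close> and \<open>\<zeta> l\<close> are distinct members
      of the spread and so share no point.\<close>
    then have "x \<noteq> z"
      using spread_line_unique[OF l polar_in_spread[OF l] x] spread_line(4)[OF l] by metis
    moreover have "\<exists>B \<in> bipartite_blocks \<zeta> S. x \<in> B \<and> z \<in> B"
      unfolding bipartite_blocks_eq using True x
      by (intro bexI[OF _ imageI[OF l]]) simp
    ultimately show ?thesis using xp zp by (simp add: arc_\<Gamma>_iff)
  next
    case False
    then have "\<not> z \<subseteq> \<zeta> x" using z by (auto simp: neighbourhood_def points_on_def)
    \<comment> \<open>Since \<open>x\<close> lies in its own plane \<open>\<zeta> x\<close>, a point
      off the plane differs from \<open>x\<close>.\<close>
    then show ?thesis using xp zp point_simps(2)[OF xp] by (auto simp: arc_\<Gamma>_iff)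
  qed
qed

lemma pverts_\<Gamma>: "pverts (\<Gamma>_graph \<zeta> S) = pg_points"
  by (simp add: \<Gamma>_graph_def complement_graph_def remove_induced_edges_def symplectic_graph_def)

lemma pair_graph_\<Gamma>: "pair_graph (\<Gamma>_graph \<zeta> S)"
proof -
  have "(z, x) \<in> parcs (\<Gamma>_graph \<zeta> S)" if "(x, z) \<in> parcs (\<Gamma>_graph \<zeta> S)" for x z
  proof -
    have "x \<in> pg_points" "z \<in> pg_points" using that by (simp_all add: arc_\<Gamma>_iff)
    then have "x \<subseteq> \<zeta> z \<longleftrightarrow> z \<subseteq> \<zeta> x"
      using orthogonal_subspace_sym[OF pol] point_simps(1) by blast
    with that show ?thesis unfolding arc_\<Gamma>_iff by blast
  qed
  moreover have "x \<in> pg_points" "z \<in> pg_points" "x \<noteq> z"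
    if "(x, z) \<in> parcs (\<Gamma>_graph \<zeta> S)" for x z
    using that by (simp_all add: arc_\<Gamma>_iff)
  ultimately show ?thesis
    by unfold_locales (fastforce simp: pverts_\<Gamma> symmetric_def intro: symI)+
qed

section \<open>Sizes of neighbourhoods and of their intersections\<close>

lemma card_pg_points: "card (pg_points :: ('a ^ 4) set set) = CARD('a)^3 + CARD('a)^2 + CARD('a) + 1"
  using card_points_on_geometric[of "UNIV :: ('a ^ 4) set"]
  by (simp add: points_on_UNIV card_cart_basis eval_nat_numeral)

lemma card_points_on_dim:
  assumes "vec.subspace (U :: ('a ^ 4) set)"
  shows "vec.dim U = 1 \<Longrightarrow> card (points_on U) = 1"
    "vec.dim U = 2 \<Longrightarrow> card (points_on U) = CARD('a) + 1"
    "vec.dim U = 3 \<Longrightarrow> card (points_on U) = CARD('a)^2 + CARD('a) + 1"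
  using card_points_on_geometric[OF assms] by (simp_all add: eval_nat_numeral)

text \<open>Reversing \<open>x \<subseteq> l\<close> gives
  \<open>\<zeta> l \<subseteq> \<zeta> x\<close>. Hence the two parts of
  \<open>neighbourhood l x\<close> are disjoint and their sizes add up.\<close>

lemma points_on_polar_line_subset:
  assumes "l \<in> S" "x \<in> points_on l"
  shows "points_on (\<zeta> l) \<subseteq> points_on (\<zeta> x)"
  using polarity_subset_iff[OF pol spread_line(2)[OF assms(1)] point_simps(1)[of x]] assms
  by (auto simp: points_on_def)

lemma card_neighbourhood:
  assumes l: "l \<in> S" and x: "x \<in> points_on l"
  shows "card (neighbourhood l x) = CARD('a)^3 + CARD('a) + 1"
proof -
  have xp: "x \<in> pg_points" using x by (simp add: points_on_def)
  have "card (neighbourhood l x) = card (pg_points - points_on (\<zeta> x)) + card (points_on (\<zeta> l))"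
    unfolding neighbourhood_def using points_on_polar_line_subset[OF l x]
    by (intro card_Un_disjoint) auto
  also have "card (points_on (\<zeta> l)) = CARD('a) + 1"
    using card_points_on_dim(2) subspace_polar spread_line[OF l] by blast
  also have "card (pg_points - points_on (\<zeta> x)) = CARD('a)^3"
    using card_points_on_dim(3)[OF subspace_polar] point_simps[OF xp]
    by (subst card_Diff_subset) (auto simp: points_on_def card_pg_points)
  finally show ?thesis by simp
qed

text \<open>Distinct points have distinct polar planes, which meet in a line. With \<open>q\<close>
  the field order, the planes cover \<open>2 * (q^2 + q + 1) - (q + 1)\<close> of the
  \<open>q^3 + q^2 + q + 1\<close> points.\<close>

lemma card_off_two_planes:
  assumes "x \<in> pg_points" "y \<in> pg_points" "x \<noteq> y"
  shows "card (pg_points - (points_on (\<zeta> x) \<union> points_on (\<zeta> y))) = CARD('a)^3 - CARD('a)^2"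
proof -
  note x = point_simps[OF assms(1)] and y = point_simps[OF assms(2)]
  have "\<not> y \<subseteq> x"
    using vec.subspace_dim_equal[OF y(1) x(1)] assms by (auto simp: pg_points_def)
  then have "\<not> \<zeta> x \<subseteq> \<zeta> y" using polarity_subset_iff[OF pol x(1) y(1)] by simp
  then have "vec.dim (\<zeta> y \<inter> \<zeta> x) = 2"
    using dim_Int_hyperplane[OF subspace_polar[OF y(1)] subspace_polar[OF x(1)] y(3)] x(3) by simp
  then have "card (points_on (\<zeta> x) \<inter> points_on (\<zeta> y)) = CARD('a) + 1"
    using card_points_on_dim(2)[of "\<zeta> y \<inter> \<zeta> x"] subspace_polar x(1) y(1)
    by (simp add: vec.subspace_inter points_on_Int Int_commute)
  moreover have "card (points_on (\<zeta> x)) = CARD('a)^2 + CARD('a) + 1"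
    "card (points_on (\<zeta> y)) = CARD('a)^2 + CARD('a) + 1"
    using card_points_on_dim(3) subspace_polar x y by blast+
  ultimately have "card (points_on (\<zeta> x) \<union> points_on (\<zeta> y)) = 2 * CARD('a)^2 + CARD('a) + 1"
    using card_Un_Int[of "points_on (\<zeta> x)" "points_on (\<zeta> y)"] by simp
  then show ?thesis
    by (subst card_Diff_subset) (auto simp: points_on_def card_pg_points)
qed

lemma card_neighbourhood_Int_same_line:
  assumes l: "l \<in> S" and x: "x \<in> points_on l" and y: "y \<in> points_on l" and "x \<noteq> y"
  shows "card (neighbourhood l x \<inter> neighbourhood l y) = CARD('a)^3 - CARD('a)^2 + CARD('a) + 1"
proof -
  have "neighbourhood l x \<inter> neighbourhood l y =
      (pg_points - (points_on (\<zeta> x) \<union> points_on (\<zeta> y))) \<union> points_on (\<zeta> l)"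
    unfolding neighbourhood_def by blast
  also have "card \<dots> = card (pg_points - (points_on (\<zeta> x) \<union> points_on (\<zeta> y))) + card (points_on (\<zeta> l))"
    using points_on_polar_line_subset[OF l x] by (intro card_Un_disjoint) auto
  also have "card (points_on (\<zeta> l)) = CARD('a) + 1"
    using card_points_on_dim(2) subspace_polar spread_line[OF l] by blast
  also have "card (pg_points - (points_on (\<zeta> x) \<union> points_on (\<zeta> y))) = CARD('a)^3 - CARD('a)^2"
    using x y \<open>x \<noteq> y\<close> by (intro card_off_two_planes) (auto simp: points_on_def)
  finally show ?thesis by simp
qed

text \<open>The inclusion \<open>\<zeta> m \<subseteq> \<zeta> x\<close> would put \<open>x\<close>
  on \<open>m\<close>. So the line \<open>\<zeta> m\<close> meets the plane in one point and keeps
  all but one of its points.\<close>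

lemma card_polar_line_minus_plane:
  assumes m: "m \<in> S" and x: "x \<in> pg_points" "x \<notin> points_on m"
  shows "card (points_on (\<zeta> m) - points_on (\<zeta> x)) = CARD('a)"
proof -
  have sub: "vec.subspace (\<zeta> x)" "vec.subspace (\<zeta> m)"
    using subspace_polar point_simps[OF x(1)] spread_line[OF m] by auto
  have "\<not> \<zeta> m \<subseteq> \<zeta> x"
    using polarity_subset_iff[OF pol spread_line(2)[OF m] point_simps(1)[OF x(1)]] x
    by (simp add: points_on_def)
  then have "vec.dim (\<zeta> x \<inter> \<zeta> m) = 1"
    using dim_Int_hyperplane[OF sub point_simps(3)[OF x(1)]] spread_line(5)[OF m] by simp
  then have "card (points_on (\<zeta> m) \<inter> points_on (\<zeta> x)) = 1"
    using card_points_on_dim(1)[of "\<zeta> x \<inter> \<zeta> m"] sub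
    by (simp add: vec.subspace_inter points_on_Int Int_commute)
  moreover have "card (points_on (\<zeta> m)) = CARD('a) + 1"
    using card_points_on_dim(2) sub spread_line[OF m] by blast
  ultimately show ?thesis by (simp add: card_Diff_subset_Int)
qed

text \<open>A point of \<open>\<zeta> l\<close> is not on the disjoint line
  \<open>\<zeta> m\<close>, so it is adjacent to \<open>y\<close> exactly when it lies off
  \<open>\<zeta> y\<close>; the same holds with the roles exchanged. The case
  \<open>m = \<zeta> l\<close> is included.\<close>

lemma card_neighbourhood_Int_different_lines:
  assumes l: "l \<in> S" and x: "x \<in> points_on l" and m: "m \<in> S" and y: "y \<in> points_on m"
    and "l \<noteq> m"
  shows "card (neighbourhood l x \<inter> neighbourhood m y) = CARD('a)^3 - CARD('a)^2 + 2 * CARD('a)"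
proof -
  have p: "x \<in> pg_points" "y \<in> pg_points" using x y by (simp_all add: points_on_def)
  have "x \<notin> points_on m" "y \<notin> points_on l"
    using spread_line_unique[OF l m] x y \<open>l \<noteq> m\<close> by blast+
  then have "x \<noteq> y" using x by blast
  have "\<zeta> l \<noteq> \<zeta> m" using polar_polar spread_line(2) l m \<open>l \<noteq> m\<close> by metis
  then have disj: "points_on (\<zeta> l) \<inter> points_on (\<zeta> m) = {}"
    using spread_line_unique polar_in_spread l m by blast
  let ?P = "pg_points - (points_on (\<zeta> x) \<union> points_on (\<zeta> y))"
  let ?L = "points_on (\<zeta> l) - points_on (\<zeta> y)" and ?M = "points_on (\<zeta> m) - points_on (\<zeta> x)"
  have sub: "points_on (\<zeta> l) \<subseteq> points_on (\<zeta> x)" "points_on (\<zeta> m) \<subseteq> points_on (\<zeta> y)"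
    using points_on_polar_line_subset l x m y by blast+
  have pts: "points_on (\<zeta> l) \<subseteq> pg_points" "points_on (\<zeta> m) \<subseteq> pg_points"
    by (auto simp: points_on_def)
  have "neighbourhood l x \<inter> neighbourhood m y = ?P \<union> (?L \<union> ?M)"
    unfolding neighbourhood_def using disj pts by blast
  \<comment> \<open>\<open>?L\<close> lies in the plane \<open>\<zeta> x\<close> and
    \<open>?M\<close> in the plane \<open>\<zeta> y\<close>, so neither meets
    \<open>?P\<close>.\<close>
  also have "card \<dots> = card ?P + card (?L \<union> ?M)"
    using sub by (intro card_Un_disjoint) auto
  also have "card (?L \<union> ?M) = card ?L + card ?M"
    using disj by (intro card_Un_disjoint) auto
  also have "card ?P = CARD('a)^3 - CARD('a)^2" using card_off_two_planes p \<open>x \<noteq> y\<close> by blast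
  also have "card ?L = CARD('a)" using card_polar_line_minus_plane l p \<open>y \<notin> points_on l\<close> by blast
  also have "card ?M = CARD('a)" using card_polar_line_minus_plane m p \<open>x \<notin> points_on m\<close> by blast
  finally show ?thesis by simp
qed

section \<open>Regularity, common neighbours and the number of classes\<close>

lemma spread_line_through:
  assumes "x \<in> pg_points"
  obtains l where "l \<in> S" "x \<in> points_on l"
  using assms partition_onD1[OF partition_points] by blast

lemma regular_\<Gamma>: "regular_graph (\<Gamma>_graph \<zeta> S) (CARD('a)^3 + CARD('a) + 1)"
proof -
  have "out_degree (with_proj (\<Gamma>_graph \<zeta> S)) x = CARD('a)^3 + CARD('a) + 1" if "x \<in> pg_points" for x
  proof -
    obtain l where l: "l \<in> S" "x \<in> points_on l" using spread_line_through \<open>x \<in> pg_points\<close> .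
    have "out_arcs (with_proj (\<Gamma>_graph \<zeta> S)) x = Pair x ` neighbourhood l x"
      using arc_\<Gamma>_iff_neighbourhood[OF l] by (auto simp: out_arcs_def)
    then show ?thesis
      using card_neighbourhood[OF l] by (simp add: out_degree_def card_image inj_on_def)
  qed
  then show ?thesis by (simp add: regular_graph_def pair_graph_\<Gamma> pverts_\<Gamma>)
qed

text \<open>The lines \<open>l\<close> and \<open>m\<close> may coincide, so this serves both common
  neighbour counts.\<close>

lemma common_neighbours_\<Gamma>:
  assumes "l \<in> S" "x \<in> points_on l" "m \<in> S" "y \<in> points_on m"
  shows "common_neighbours (\<Gamma>_graph \<zeta> S) x y = neighbourhood l x \<inter> neighbourhood m y"
proof -
  have "z \<in> pg_points" if "(x, z) \<in> parcs (\<Gamma>_graph \<zeta> S)" for z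
    using that by (simp add: arc_\<Gamma>_iff)
  then show ?thesis
    using arc_\<Gamma>_iff_neighbourhood[OF assms(1,2)] arc_\<Gamma>_iff_neighbourhood[OF assms(3,4)]
    by (auto simp: common_neighbours_def pverts_\<Gamma>)
qed

lemma card_spread_line:
  assumes "l \<in> S"
  shows "card (points_on l) = CARD('a) + 1"
  using card_points_on_dim(2)[OF spread_line(2)[OF assms]] spread_line(1)[OF assms]
  by (simp add: pg_lines_def)

text \<open>The disjoint classes have \<open>q + 1\<close> points each, and the total factors as
  \<open>(q + 1) * (q^2 + 1)\<close> for \<open>q\<close> the field order.\<close>

lemma card_classes: "card (points_on ` S) = CARD('a)^2 + 1"
proof -
  have "(CARD('a) + 1) * card (points_on ` S) = card (\<Union>(points_on ` S))"
  proof (rule card_partition)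
    show "c1 \<inter> c2 = {}" if "c1 \<in> points_on ` S" "c2 \<in> points_on ` S" "c1 \<noteq> c2" for c1 c2
      using disjointD[OF partition_onD2[OF partition_points]] that by blast
  qed (auto simp: card_spread_line)
  also have "\<dots> = (CARD('a) + 1) * (CARD('a)^2 + 1)"
    using partition_onD1[OF partition_points] card_pg_points
    by (simp add: algebra_simps power2_eq_square power3_eq_cube)
  finally show ?thesis by (simp only: mult_cancel1) simp
qed

end

theorem theorem1:
  fixes \<zeta> :: "('a::{field,finite} ^ 4) set \<Rightarrow> ('a ^ 4) set"
    and S :: "('a ^ 4) set set"
    and q :: nat
  assumes "primepow q" and "odd q" and "CARD('a) = q"
    and "symplectic_polarity \<zeta>"
    and "special_spread \<zeta> S"
  shows "divisible_design_graph (\<Gamma>_graph \<zeta> S)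
           ((q^2 + 1) * (q + 1)) (q^3 + q + 1)
           (q^3 - q^2 + q + 1) (q^3 - q^2 + 2 * q) (q^2 + 1) (q + 1)"
proof -
  interpret special_spread_polarity \<zeta> S by unfold_locales fact+
  have q: "q = CARD('a)" using assms(3) by simp
  have "card (pverts (\<Gamma>_graph \<zeta> S)) = (q^2 + 1) * (q + 1)"
    unfolding pverts_\<Gamma> card_pg_points q by (simp add: algebra_simps power2_eq_square power3_eq_cube)
  \<comment> \<open>The classes of the design are the point sets of single spread lines, not the
    blocks formed by a line and its partner.\<close>
  moreover have "partition_on (pverts (\<Gamma>_graph \<zeta> S)) (points_on ` S)"
    using partition_points by (simp add: pverts_\<Gamma>)
  moreover have "\<forall>C \<in> points_on ` S. card C = q + 1" by (simp add: card_spread_line q)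
  moreover have "\<forall>C \<in> points_on ` S. \<forall>x \<in> C. \<forall>y \<in> C. x \<noteq> y \<longrightarrow>
      card (common_neighbours (\<Gamma>_graph \<zeta> S) x y) = q^3 - q^2 + q + 1"
    using common_neighbours_\<Gamma> card_neighbourhood_Int_same_line by (simp add: q)
  moreover have "\<forall>C \<in> points_on ` S. \<forall>D \<in> points_on ` S. C \<noteq> D \<longrightarrow>
      (\<forall>x \<in> C. \<forall>y \<in> D. card (common_neighbours (\<Gamma>_graph \<zeta> S) x y) = q^3 - q^2 + 2 * q)"
  proof (clarify)
    fix l m x y assume *: "l \<in> S" "m \<in> S" "points_on l \<noteq> points_on m" "x \<in> points_on l" "y \<in> points_on m"
    then have "l \<noteq> m" by blast
    with * show "card (common_neighbours (\<Gamma>_graph \<zeta> S) x y) = q^3 - q^2 + 2 * q"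
      by (simp add: common_neighbours_\<Gamma> card_neighbourhood_Int_different_lines q)
  qed
  ultimately show ?thesis
    using regular_\<Gamma> card_classes unfolding divisible_design_graph_def q by blast
qed

end
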